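(* Let $X$ be a multi-set of size $n$. For every integer $m$ with \[ 2\max(X) \le m \le \frac{n^2}{33984\,\mu_X\log(2n)\log^2(2\mu_X)}, \] the set $\mathcal{S}(X)$ contains an arithmetic progression $\mathcal{P}$ of length $m$ and step size $s \le 4248\,\mu_X\max(X)\log(2\mu_X)/n$. Moreover, every element of $\mathcal{P}$ can be obtained as the sum of at most $4248\,m\,\mu_X\log(2\mu_X)/n$ distinct elements of $X$, and we have $\max(\mathcal{P}) \le 4248\,m\,\mu_X\max(X)\log(2\mu_X)/n$.
   Context: For a finite non-empty multi-set $X$ of positive integers: $n=|X|$ is the number of elements counted with multiplicity, $\max(X)$ its maximum element, $\mu_X$ the largest multiplicity of any number in $X$, and $\mathcal{S}(X)$ the set of all subset sums $\{\Sigma(Y)\mid Y\subseteq X\}$. An arithmetic progression of length $m$ and step size $s$ is a set $\{a+s,a+2s,\dots,a+ms\}$. "Distinct elements" means that any integer $x$ may be chosen up to its multiplicity in $X$ times. *)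

theory Defs
  imports Complex_Main "HOL-Library.Multiset"
begin

definition max_elem :: "int multiset \<Rightarrow> int" where
  "max_elem X = Max (set_mset X)"

definition max_mult :: "int multiset \<Rightarrow> nat" where
  "max_mult X = Max (count X ` set_mset X)"

definition subset_sums :: "int multiset \<Rightarrow> int set" where
  "subset_sums X = {sum_mset Y | Y. Y \<subseteq># X}"

(* The step size is positive, so that the progression really has m elements;
   the offset a may be negative, so the first element a + s may be smaller than s. *)
definition arith_prog :: "int \<Rightarrow> int \<Rightarrow> int set \<Rightarrow> bool" where
  "arith_prog m s P \<longleftrightarrow> 0 < s \<and> (\<exists>a. P = {a + i * s | i. 1 \<le> i \<and> i \<le> m})"

(* The logarithm is binary: log (2 * mu) counts the dyadic classes of multiplicities
   up to mu and equals 1 when X is a set. *)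
abbreviation lg :: "real \<Rightarrow> real" where
  "lg x \<equiv> log 2 x"

end

theory Submission
  imports Defs "HOL-Algebra.Elementary_Groups" "HOL-Computational_Algebra.Group_Closure"
begin

text \<open>
  Pass to a dyadic class of multiplicities: \<open>N\<close> distinct numbers, each occurring at least \<open>M\<close>
  times. Double counting of pairs yields a threshold \<open>t\<close> and a set \<open>S\<close> of at least \<open>N / 8\<close>
  numbers, each of them a sum of two class members in at least \<open>t\<close> ways, with
  \<open>t * card S\<close> of order \<open>N\<^sup>2 / log N\<close>. As long as \<open>2 * k \<le> t * M\<close>, any sum of \<open>k\<close> elements
  of \<open>S\<close>, repetitions allowed, can be turned greedily into a subset sum of \<open>X\<close>.

  It remains to find a long progression among such sums. After translating and dividing by the
  gcd, \<open>S\<close> contains \<open>0\<close> and its maximum \<open>q\<close>, and it generates the cyclic group of order \<open>q\<close>.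
  In a finite group, multiplying by a generating set \<open>B\<close> that contains \<open>1\<close> enlarges a set by at
  least \<open>card B / 2\<close> until the whole group is reached. So \<open>O(q / card S)\<close> summands
  reach all residues modulo \<open>q\<close>, and further copies of \<open>q\<close> fill a long interval.
\<close>

section \<open>Growth of product sets in finite groups\<close>

context group
begin

lemma card_l_coset: "M \<subseteq> carrier G \<Longrightarrow> g \<in> carrier G \<Longrightarrow> card (g <# M) = card M"
  using card_image[OF inj_on_subset[OF inj_on_cmult[of g]], of M]
  by (simp add: l_coset_def UNION_singleton_eq_range)

text \<open>If \<open>x \<otimes> inv c\<close> were in \<open>F\<close>, then \<open>x\<close>
  would lie in \<open>F <#> C\<close>. This duality trades a set for the complement of its product,
  at the price of inverting \<open>C\<close>.\<close>

lemma set_mult_complement_inverse: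
  assumes "F \<subseteq> carrier G" "C \<subseteq> carrier G"
  shows "(carrier G - (F <#> C)) <#> (m_inv G ` C) \<subseteq> carrier G - F"
proof -
  have "x \<otimes> inv c \<notin> F" if "x \<in> carrier G" "x \<notin> F <#> C" "c \<in> C" for x c
  proof
    assume "x \<otimes> inv c \<in> F"
    moreover have "x = x \<otimes> inv c \<otimes> c"
      using that assms by (simp add: m_assoc subset_iff)
    ultimately show False
      using that unfolding set_mult_def by blast
  qed
  then show ?thesis
    using assms unfolding set_mult_def by auto
qed

lemma subset_set_mult:
  assumes "F \<subseteq> carrier G" "\<one> \<in> C"
  shows "F \<subseteq> F <#> C"
  using assms unfolding set_mult_def by force

text \<open>
  Hamidoune's isoperimetric argument: among the sets \<open>F\<close> that minimise
  \<open>card (F <#> C) - card F\<close>, where \<open>C\<close> is \<open>B\<close> or its inverse, one of least cardinality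
  meets each of its translates trivially or entirely, so it is a subgroup up to translation.
  Allowing both \<open>B\<close> and its inverse makes the family closed under
  \<open>F \<mapsto> carrier G - (F <#> C)\<close>.
\<close>
theorem card_set_mult_generating:
  assumes fin: "finite (carrier G)" and B: "B \<subseteq> carrier G" "\<one> \<in> B"
    and gen: "\<And>H. subgroup H G \<Longrightarrow> B \<subseteq> H \<Longrightarrow> H = carrier G"
    and F: "F \<subseteq> carrier G" "F \<noteq> {}" "F <#> B \<noteq> carrier G"
  shows "2 * card F + card B \<le> 2 * card (F <#> B)"
proof -
  define I where "I = m_inv G ` B"
  define Q where "Q = (\<lambda>(C, E). (C = B \<or> C = I) \<and> E \<subseteq> carrier G \<and> E \<noteq> {} \<and> E <#> C \<noteq> carrier G)"
  \<comment> \<open>The natural subtraction never truncates here: \<open>\<one> \<in> C\<close>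
    gives \<open>card E \<le> card (E <#> C)\<close>, recorded as \<open>le\<close> below.\<close>
  define defect where "defect = (\<lambda>(C, E). card (E <#> C) - card E)"
  have I: "I \<subseteq> carrier G" "\<one> \<in> I" "m_inv G ` I = B"
    using B by (auto simp: I_def image_image image_iff subset_iff) force+
  have Iinv: "m_inv G ` B = I" by (simp add: I_def)
  have "Q (B, F)" using F by (simp add: Q_def)
  then obtain p0 where p0: "Q p0" "\<And>p. Q p \<Longrightarrow> defect p0 \<le> defect p"
    using ex_has_least_nat[of Q _ defect] by blast
  obtain p where p: "Q p" "defect p = defect p0"
      "\<And>p'. Q p' \<Longrightarrow> defect p' = defect p0 \<Longrightarrow> card (snd p) \<le> card (snd p')"
    using ex_has_least_nat[of "\<lambda>p. Q p \<and> defect p = defect p0" p0 "\<lambda>p. card (snd p)"] p0(1) by auto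
  obtain C M where pCM: "p = (C, M)" by force
  have C: "C \<subseteq> carrier G" "\<one> \<in> C" "C = B \<or> C = I"
    and M: "M \<subseteq> carrier G" "M \<noteq> {}" "M <#> C \<noteq> carrier G"
    using p(1) B I unfolding pCM Q_def by auto
  have min_def: "defect (C, M) \<le> defect p'" if "Q p'" for p'
    using p0 p that unfolding pCM by simp
  have min_card: "card M \<le> card E" if "Q (C', E)" "defect (C', E) \<le> defect (C, M)" for C' E
    using p(2,3) that min_def[OF that(1)] unfolding pCM by fastforce
  have sub: "E <#> C' \<subseteq> carrier G" if "E \<subseteq> carrier G" "C' = B \<or> C' = I" for E C'
    using set_mult_closed[OF that(1), of C'] that(2) B(1) I(1) by blast
  have finsub: "finite E" if "E \<subseteq> carrier G" for E using that fin finite_subset by blast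
  have le: "card E \<le> card (E <#> C')" if "E \<subseteq> carrier G" "C' = B \<or> C' = I" for E C'
    using that subset_set_mult[of E C'] B I sub[OF that] finsub by (intro card_mono) auto

  \<comment> \<open>The complement of \<open>M <#> C\<close> is admissible and its defect is no
    larger, so the minimality of \<open>card M\<close> applies to it.\<close>
  have dual: "card M + card (M <#> C) \<le> card (carrier G)"
  proof -
    let ?E = "carrier G - (M <#> C)" and ?J = "m_inv G ` C"
    have J: "?J = B \<or> ?J = I" using C(3) I Iinv by auto
    have s: "?E <#> ?J \<subseteq> carrier G - M"
      by (rule set_mult_complement_inverse) (use M C in auto)
    have Q: "Q (?J, ?E)" unfolding Q_def using J M sub[OF M(1) C(3)] s by auto
    have c1: "card (?E <#> ?J) \<le> card (carrier G) - card M"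
      using card_mono[OF _ s] fin M finsub by (simp add: card_Diff_subset)
    have c2: "card ?E = card (carrier G) - card (M <#> C)"
      using sub[OF M(1) C(3)] fin finsub by (simp add: card_Diff_subset)
    have c3: "card (M <#> C) \<le> card (carrier G)"
      using sub[OF M(1) C(3)] fin by (simp add: card_mono)
    have "defect (?J, ?E) \<le> defect (C, M)"
      unfolding defect_def using c1 c2 c3 le[OF M(1) C(3)] by simp
    then have "card M \<le> card ?E" using min_card Q by blast
    then show ?thesis using c2 c3 by simp
  qed

  \<comment> \<open>Submodularity: the defects of the intersection and the union of \<open>M\<close>
    and its translate add up to at most twice the minimum. A proper intersection has strictly larger
    defect, so the union would fall below the minimum. If the product of the union is the whole
    group, \<open>dual\<close> yields the contradiction.\<close>
  have translate: "g <# M = M" if g: "g \<in> carrier G" and meet: "M \<inter> (g <# M) \<noteq> {}" for g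
  proof (rule ccontr)
    assume neq: "g <# M \<noteq> M"
    define N where "N = g <# M"
    have N: "N \<subseteq> carrier G" "card N = card M"
      using g M l_coset_subset_G card_l_coset unfolding N_def by auto
    have NC: "card (N <#> C) = card (M <#> C)"
    proof -
      have "N <#> C = g <# (M <#> C)"
        unfolding N_def l_coset_eq_set_mult using set_mult_assoc g M C by auto
      then show ?thesis using card_l_coset[OF sub[OF M(1) C(3)] g] by simp
    qed
    let ?X = "M \<inter> N" and ?Y = "M \<union> N"
    have X: "?X \<subseteq> carrier G" "?X \<noteq> {}" and Y: "?Y \<subseteq> carrier G" "?Y \<noteq> {}"
      using M N meet N_def by auto
    have XC: "?X <#> C \<subseteq> (M <#> C) \<inter> (N <#> C)" and YC: "?Y <#> C = (M <#> C) \<union> (N <#> C)"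
      unfolding set_mult_def by auto
    have cX: "card ?X < card M"
    proof (rule psubset_card_mono)
      show "finite M" using M finsub by auto
      have "\<not> M \<subseteq> N" using N neq card_subset_eq[of N M] finsub unfolding N_def by auto
      then show "?X \<subset> M" by blast
    qed
    have QX: "Q (C, ?X)"
      unfolding Q_def using C X XC M sub[OF M(1) C(3)] by auto
    have dX: "defect (C, M) < defect (C, ?X)"
      using min_card[OF QX] cX by linarith
    have u: "card ?Y + card ?X = 2 * card M"
      using card_Un_Int[of M N] M N finsub by simp
    have fMC: "finite (M <#> C)" "finite (N <#> C)" using sub C M N finsub by auto
    have "card (?Y <#> C) + card ((M <#> C) \<inter> (N <#> C)) = 2 * card (M <#> C)"
      using card_Un_Int[OF fMC] NC YC by simp
    moreover have "card (?X <#> C) \<le> card ((M <#> C) \<inter> (N <#> C))"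
      using XC fMC by (intro card_mono) auto
    ultimately have v: "card (?Y <#> C) + card (?X <#> C) \<le> 2 * card (M <#> C)" by linarith
    have les: "card M \<le> card (M <#> C)" "card ?X \<le> card (?X <#> C)" "card ?Y \<le> card (?Y <#> C)"
      using le M X Y C by blast+
    show False
    proof (cases "?Y <#> C = carrier G")
      case True
      have "card ?X > 0" using X finsub by (simp add: card_gt_0_iff)
      then show False using True v dX les dual unfolding defect_def by simp
    next
      case False
      have "Q (C, ?Y)" unfolding Q_def using C Y False by auto
      from min_def[OF this] show False using v u dX les unfolding defect_def by simp
    qed
  qed

  obtain x0 where x0: "x0 \<in> M" using M by auto
  have x0c: "x0 \<in> carrier G" using x0 M by auto
  define H where "H = inv x0 <# M"
  have H: "H \<subseteq> carrier G" "\<one> \<in> H" and cH: "card H = card M"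
    using x0 x0c M l_coset_subset_G card_l_coset unfolding H_def
    by (auto simp: l_coset_def intro!: bexI[of _ x0])
  have MH: "M = x0 <# H"
    unfolding H_def using x0c M by (simp add: lcos_m_assoc lcos_mult_one)
  have Htr: "x \<otimes> y \<in> H \<longleftrightarrow> y \<in> H" if x: "x \<in> H" and y: "y \<in> carrier G" for x y
  proof -
    have xc: "x \<in> carrier G" using x H by auto
    \<comment> \<open>Left multiplication by \<open>x\<close> on \<open>H\<close> corresponds to
      left multiplication by this conjugate on \<open>M = x0 <# H\<close>, where
      \<open>translate\<close> applies because both sets contain
      \<open>x0 \<otimes> x\<close>.\<close>
    let ?g = "x0 \<otimes> x \<otimes> inv x0"
    have gc: "?g \<in> carrier G" using xc x0c by simp
    have gM: "?g <# M = x0 <# (x <# H)"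
      unfolding H_def using xc x0c M by (simp add: lcos_m_assoc l_coset_subset_G m_assoc)
    have "x0 \<otimes> x \<in> M" using x unfolding MH l_coset_def by auto
    moreover have "x0 \<otimes> x \<in> ?g <# M"
      unfolding gM using H xc by (force simp: l_coset_def)
    ultimately have "?g <# M = M" using translate[OF gc] by blast
    then have "x0 <# (x <# H) = x0 <# H" using gM MH by simp
    then have "inv x0 <# (x0 <# (x <# H)) = inv x0 <# (x0 <# H)" by simp
    moreover have "inv x0 \<otimes> (x0 \<otimes> x) = x"
      using x0c xc m_assoc[of "inv x0" x0 x] by simp
    ultimately have xH: "x <# H = H"
      using x0c xc H by (simp add: lcos_m_assoc lcos_mult_one l_coset_subset_G)
    have "x \<otimes> y \<in> x <# H \<longleftrightarrow> y \<in> H"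
      unfolding l_coset_def using xc y H by (auto simp: subset_iff)
    then show ?thesis using xH by simp
  qed
  have subH: "subgroup H G"
  proof (rule subgroupI)
    show "inv a \<in> H" if "a \<in> H" for a
      using Htr[of a "inv a"] that H by (auto simp: subset_iff)
    show "a \<otimes> b \<in> H" if "a \<in> H" "b \<in> H" for a b
      using Htr[of a b] that H by (auto simp: subset_iff)
  qed (use H in auto)
  have HC: "card (H <#> C) = card (M <#> C)"
  proof -
    have "M <#> C = x0 <# (H <#> C)"
      unfolding MH l_coset_eq_set_mult using set_mult_assoc x0c H C by auto
    then show ?thesis using card_l_coset[OF sub[OF H(1) C(3)] x0c] by simp
  qed
  \<comment> \<open>Otherwise generation forces \<open>H\<close>, and with it
    \<open>M <#> C\<close>, to be everything. An element of \<open>C\<close> outside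
    \<open>H\<close> supplies a second coset, so multiplication by \<open>C\<close> at least doubles
    \<open>H\<close>.\<close>
  have "\<not> C \<subseteq> H"
  proof
    assume "C \<subseteq> H"
    then have "B \<subseteq> H" using C(3) I(3) subgroup.m_inv_closed[OF subH] by auto
    then have "H = carrier G" using gen subH by blast
    then have "card (carrier G) \<le> card (M <#> C)" using le[OF H(1) C(3)] HC by simp
    then show False using M sub[OF M(1) C(3)] fin card_subset_eq[of "carrier G" "M <#> C"]
      by (meson card_seteq)
  qed
  then obtain c where c: "c \<in> C" "c \<notin> H" by auto
  have cc: "c \<in> carrier G" using c C by auto
  have disj: "H \<inter> (H #> c) = {}"
  proof -
    have "x \<otimes> c \<notin> H" if "x \<in> H" for x using Htr[of x c] that c cc by auto
    then show ?thesis unfolding r_coset_def by auto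
  qed
  have "H \<union> (H #> c) \<subseteq> H <#> C"
    using subset_set_mult[OF H(1) C(2)] c unfolding r_coset_def set_mult_def by auto
  then have "card (H \<union> (H #> c)) \<le> card (H <#> C)"
    using sub[OF H(1) C(3)] finsub by (intro card_mono) auto
  moreover have "card (H \<union> (H #> c)) = 2 * card H"
  proof -
    have "card (H #> c) = card H"
      using card_rcosets_equal[OF rcosetsI[OF H(1) cc] H(1)] by simp
    then show ?thesis
      using card_Un_disjoint[OF _ _ disj] finsub H r_coset_subset_G[OF H(1) cc] by simp
  qed
  ultimately have double: "2 * card M \<le> card (M <#> C)" using HC cH by simp
  have "card C = card B"
    using C(3) B unfolding I_def by (auto intro!: card_image inj_on_subset[OF inv_inj])
  moreover have "card C \<le> card (H <#> C)"
  proof (rule card_mono)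
    show "finite (H <#> C)" using sub[OF H(1) C(3)] finsub by auto
    show "C \<subseteq> H <#> C"
    proof
      fix x assume x: "x \<in> C"
      then have "x = \<one> \<otimes> x" using C by (simp add: subset_iff)
      then show "x \<in> H <#> C" using x H unfolding set_mult_def by blast
    qed
  qed
  ultimately have "card B \<le> card (M <#> C)" using HC by simp
  moreover have "defect (C, M) \<le> defect (B, F)" using min_def \<open>Q (B, F)\<close> by blast
  \<comment> \<open>By \<open>double\<close>, the minimal defect is at least half of
    \<open>card (M <#> C)\<close>, hence at least \<open>card B / 2\<close>.\<close>
  ultimately show ?thesis
    using double le[OF F(1), of B] unfolding defect_def by simp
qed

text \<open>Each multiplication adds at least \<open>card B / 2\<close> elements until the group is
  full. Starting from one element, \<open>h\<close> steps short of the whole group would produce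
  more than \<open>card (carrier G)\<close> elements.\<close>

corollary set_mult_power_eq_carrier:
  assumes fin: "finite (carrier G)" and B: "B \<subseteq> carrier G" "\<one> \<in> B"
    and gen: "\<And>H. subgroup H G \<Longrightarrow> B \<subseteq> H \<Longrightarrow> H = carrier G"
    and h: "2 * card (carrier G) \<le> h * card B"
  shows "((\<lambda>F. F <#> B) ^^ h) {\<one>} = carrier G"
proof -
  define R where "R = (\<lambda>i. ((\<lambda>F. F <#> B) ^^ i) {\<one>})"
  have R: "R i \<subseteq> carrier G" for i
    unfolding R_def by (induction i) (use B set_mult_closed in auto)
  have "R i \<noteq> {} \<and> (R i = carrier G \<or> 2 + i * card B \<le> 2 * card (R i))" for i
  proof (induction i)
    case 0
    then show ?case by (simp add: R_def)
  next
    case (Suc i)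
    have S: "R (Suc i) = R i <#> B" by (simp add: R_def)
    have sub: "R i \<subseteq> R (Suc i)" using subset_set_mult[OF R B(2)] S by simp
    show ?case
    proof (cases "R (Suc i) = carrier G")
      case True
      then show ?thesis using Suc sub by auto
    next
      case False
      then have "R i \<noteq> carrier G" using sub R[of "Suc i"] by auto
      moreover have "2 * card (R i) + card B \<le> 2 * card (R (Suc i))"
        unfolding S using False Suc S by (intro card_set_mult_generating fin B gen R) auto
      ultimately show ?thesis using Suc sub by auto
    qed
  qed
  from this[of h] have "R h = carrier G \<or> 2 + h * card B \<le> 2 * card (R h)" by blast
  moreover have "card (R h) \<le> card (carrier G)" using R fin card_mono by blast
  ultimately show ?thesis using h unfolding R_def by auto
qed

end

section \<open>Progressions in iterated sumsets\<close>

text \<open>This is the growth result in the cyclic group of order \<open>q\<close>: since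
  \<open>Gcd A = 1\<close>, the set \<open>A\<close> generates the integers, so its residues
  generate the group.\<close>

lemma sums_cover_residues:
  fixes A :: "int set" and q :: int
  assumes A: "A \<subseteq> {0..q}" "0 \<in> A" "q \<in> A" "0 < q" "Gcd A = 1"
    and h: "2 * q \<le> int (h * (card A - 1))"
  shows "\<exists>Z. set_mset Z \<subseteq> A \<and> size Z = h \<and> sum_mset Z mod q = r mod q"
proof -
  define G where "G = integer_mod_group (nat q)"
  interpret G: group G by (simp add: G_def)
  \<comment> \<open>\<open>q\<close> and \<open>0\<close> are the same residue; dropping
    \<open>q\<close> leaves distinct residues and accounts for \<open>card A - 1\<close>.\<close>
  define B where "B = A - {q}"
  have car: "carrier G = {0..<q}" using A by (simp add: G_def carrier_integer_mod_group)
  have mult: "x \<otimes>\<^bsub>G\<^esub> y = (x + y) mod q" for x y using A by (simp add: G_def)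
  have one: "\<one>\<^bsub>G\<^esub> = 0" by (simp add: G_def)
  have finA: "finite A" using A finite_subset by blast
  have B: "B \<subseteq> carrier G" "\<one>\<^bsub>G\<^esub> \<in> B" using A car one unfolding B_def by force+
  have cB: "card B = card A - 1" unfolding B_def using A finA by simp
  have gen: "H = carrier G" if H: "subgroup H G" "B \<subseteq> H" for H
  proof -
    have "x mod q \<in> H" if "x \<in> group_closure A" for x
      using that
    proof (induction rule: group_closure.induct)
      case (base s)
      then have "s \<in> A" using A by auto
      show ?case
      proof (cases "s = q")
        case True
        then show ?thesis using H(2) B(2) one by auto
      next
        case False
        then have "s \<in> B" using \<open>s \<in> A\<close> unfolding B_def by simp
        moreover have "s mod q = s" using \<open>s \<in> B\<close> B(1) car by auto
        ultimately show ?thesis using H(2) by auto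
      qed
    next
      case (diff s t)
      have inv: "m_inv G (t mod q) = (- (t mod q)) mod q"
        using A car unfolding G_def by (subst inv_integer_mod_group) auto
      have "(s mod q) \<otimes>\<^bsub>G\<^esub> m_inv G (t mod q) \<in> H"
        using diff subgroup.m_closed[OF H(1)] subgroup.m_inv_closed[OF H(1)] by blast
      then show ?case unfolding mult inv by (simp add: mod_simps)
    qed
    moreover have "y \<in> group_closure A" for y
      using group_closure_mult_left[OF Gcd_in_group_closure[of A], of y] A by simp
    ultimately have "y \<in> H" if "y \<in> carrier G" for y
      using that car by (metis atLeastLessThan_iff mod_pos_pos_trivial)
    then show ?thesis using subgroup.subset[OF H(1)] by blast
  qed
  have cover: "((\<lambda>F. F <#>\<^bsub>G\<^esub> B) ^^ h) {\<one>\<^bsub>G\<^esub>} = carrier G"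
  proof (rule G.set_mult_power_eq_carrier[OF _ B gen])
    have "int (2 * card (carrier G)) = 2 * q" using car A by simp
    then have "int (2 * card (carrier G)) \<le> int (h * card B)" using h cB by metis
    then show "2 * card (carrier G) \<le> h * card B" by (simp only: of_nat_le_iff)
  qed (simp add: car)
  have "\<exists>Z. set_mset Z \<subseteq> A \<and> size Z = i \<and> sum_mset Z mod q = x"
    if "x \<in> ((\<lambda>F. F <#>\<^bsub>G\<^esub> B) ^^ i) {\<one>\<^bsub>G\<^esub>}" for i x
    using that
  proof (induction i arbitrary: x)
    case 0
    then show ?case by (simp add: one)
  next
    case (Suc i)
    then obtain y b where y: "y \<in> ((\<lambda>F. F <#>\<^bsub>G\<^esub> B) ^^ i) {\<one>\<^bsub>G\<^esub>}" and b: "b \<in> B"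
      and x: "x = (y + b) mod q"
      by (auto simp: set_mult_def mult)
    from Suc.IH[OF y] obtain Z where Z: "set_mset Z \<subseteq> A" "size Z = i" "sum_mset Z mod q = y" by blast
    have "sum_mset (add_mset b Z) mod q = x"
      unfolding x Z(3)[symmetric] by (simp add: mod_simps add.commute)
    then show ?case using Z b B_def by (intro exI[of _ "add_mset b Z"]) auto
  qed
  moreover have "r mod q \<in> carrier G" using A car by simp
  ultimately show ?thesis using cover by blast
qed

text \<open>
  Once \<open>h\<close>-fold sums cover all residues modulo \<open>q = Max A\<close>, copies of \<open>q\<close> and of \<open>0\<close>
  reach every integer of a long interval with a constant number of summands.
\<close>
lemma sums_cover_interval:
  fixes A :: "int set" and q :: int
  assumes A: "A \<subseteq> {0..q}" "0 \<in> A" "q \<in> A" "0 < q" "Gcd A = 1"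
    and h: "2 * q \<le> int (h * (card A - 1))"
    and y: "int h * q \<le> y" "y \<le> int K * q"
  shows "\<exists>Z. set_mset Z \<subseteq> A \<and> size Z = h + K \<and> sum_mset Z = y"
proof -
  obtain Z where Z: "set_mset Z \<subseteq> A" "size Z = h" "sum_mset Z mod q = y mod q"
    using sums_cover_residues[OF A h] by blast
  have bound: "0 \<le> sum_mset W \<and> sum_mset W \<le> int (size W) * q" if "set_mset W \<subseteq> A" for W
    using that
  proof (induction W)
    case (add x W)
    then have "0 \<le> x" "x \<le> q" using A by auto
    then show ?case using add by (simp add: algebra_simps)
  qed simp
  have "q dvd y - sum_mset Z" using Z(3) by (metis mod_eq_dvd_iff)
  then obtain j where j: "y - sum_mset Z = q * j" by blast
  have "0 \<le> q * j" using bound[OF Z(1)] Z(2) y j by simp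
  then have j0: "0 \<le> j" using A by (simp add: zero_le_mult_iff)
  have "q * j \<le> q * int K" using bound[OF Z(1)] y j by (simp add: algebra_simps)
  then have jK: "j \<le> int K" using A by simp
  let ?Z = "Z + replicate_mset (nat j) q + replicate_mset (K - nat j) 0"
  have "set_mset ?Z \<subseteq> A" using Z A by (auto split: if_splits)
  moreover have "size ?Z = h + K" using Z jK by simp
  moreover have "sum_mset ?Z = y" using j j0 by (simp add: sum_mset_replicate_mset algebra_simps)
  ultimately show ?thesis by blast
qed

text \<open>Shifting the minimum of \<open>A\<close> to \<open>0\<close> and dividing by the gcd of
  the differences reduces this to \<open>sums_cover_interval\<close>. The number of summands there
  is fixed, so undoing the shift only changes the offset, and the gcd becomes the step size.\<close>

theorem sums_contain_progression:
  fixes A :: "int set" and l m :: int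
  assumes A: "A \<subseteq> {1..l}" "A \<noteq> {}" and m: "l \<le> m"
  shows "\<exists>d a k. 0 < d \<and> d * int (card A) \<le> 16 * l \<and> int k * int (card A) \<le> 16 * m \<and>
           (\<forall>i\<in>{1..m}. \<exists>Z. set_mset Z \<subseteq> A \<and> size Z \<le> k \<and> sum_mset Z = a + i * d)"
\<comment> \<open>A singleton has no nonzero difference, so the gcd would be \<open>0\<close>; the
  multiples of its element form the progression.\<close>
proof (cases "card A = 1")
  case True
  then obtain x where x: "A = {x}" by (auto simp: card_1_singleton_iff)
  have "\<exists>Z. set_mset Z \<subseteq> A \<and> size Z \<le> nat m \<and> sum_mset Z = 0 + i * x" if "i \<in> {1..m}" for i
    using that x by (intro exI[of _ "replicate_mset (nat i) x"]) (auto simp: sum_mset_replicate_mset)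
  moreover have "0 < x" "x \<le> l" using A x by auto
  ultimately show ?thesis using x m by (intro exI[of _ x] exI[of _ 0] exI[of _ "nat m"]) auto
next
  case False
  have finA: "finite A" using A finite_subset by blast
  define n where "n = int (card A) - 1"
  have n: "1 \<le> n" using False A finA unfolding n_def by (cases "card A") auto
  define u where "u = Min A"
  define g where "g = Gcd ((\<lambda>x. x - u) ` A)"
  define A' where "A' = (\<lambda>x. (x - u) div g) ` A"
  define q where "q = Max A'"
  have u: "u \<in> A" "\<And>x. x \<in> A \<Longrightarrow> u \<le> x" using finA A unfolding u_def by auto
  have "\<exists>x\<in>A. x \<noteq> u" using False u(1) by (metis card_1_singleton_iff is_singletonI' is_singleton_altdef empty_iff)
  then obtain w where w: "w \<in> A" "w \<noteq> u" by blast
  have g0: "g > 0"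
  proof -
    have "g \<ge> 0" unfolding g_def by simp
    moreover have "g \<noteq> 0" using w unfolding g_def by auto
    ultimately show ?thesis by simp
  qed
  have gd: "g dvd x - u" if "x \<in> A" for x using that unfolding g_def by (auto intro: Gcd_dvd)
  have gx: "g * ((x - u) div g) = x - u" if "x \<in> A" for x using gd[OF that] by simp
  have inj: "inj_on (\<lambda>x. (x - u) div g) A" by (rule inj_onI) (metis gx diff_add_cancel)
  have cA': "int (card A') = n + 1" unfolding A'_def card_image[OF inj] n_def by simp
  have finA': "finite A'" "A' \<noteq> {}" unfolding A'_def using finA A by auto
  have A'0: "0 \<in> A'" unfolding A'_def using u by force
  have A'pos: "0 \<le> y" if "y \<in> A'" for y using that u g0 unfolding A'_def by (auto simp: pos_imp_zdiv_nonneg_iff)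
  have q: "q \<in> A'" using finA' unfolding q_def by auto
  have A'q: "A' \<subseteq> {0..q}" using A'pos finA' unfolding q_def by auto
  have nq: "n \<le> q" using card_mono[OF _ A'q] cA' A'pos[OF q] by simp
  have q0: "0 < q" using nq n by simp
  have gq: "g * q \<le> l"
  proof -
    obtain x where x: "x \<in> A" "q = (x - u) div g" using q unfolding A'_def by auto
    then have "g * q = x - u" using gx by simp
    moreover have "x \<le> l" "1 \<le> u" using x A(1) u(1) by auto
    ultimately show ?thesis by simp
  qed
  have "q \<le> g * q" using g0 q0 by simp
  then have qm: "q \<le> m" using gq m by linarith
  have Gcd1: "Gcd A' = 1"
  proof -
    have "(\<lambda>x. x - u) ` A = (*) g ` A'" unfolding A'_def image_image using gx by auto
    then have "g = g * Gcd A'" unfolding g_def using Gcd_mult[of g A'] g0 g_def by (simp add: normalize_mult)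
    then show ?thesis using g0 by simp
  qed
  \<comment> \<open>\<open>h\<close> exceeds \<open>2 * q / n\<close>, as covering all residues
    requires; \<open>K\<close> is large enough that the \<open>m\<close> integers after
    \<open>h * q\<close> stay below \<open>K * q\<close>.\<close>
  define h where "h = nat (2 * q div n + 1)"
  define K where "K = h + nat (m div q + 1)"
  have h1: "2 * q \<le> int h * n" 
  proof -
    have "int h = 2 * q div n + 1" unfolding h_def using n q0 by (simp add: pos_imp_zdiv_nonneg_iff)
    then have "int h * n = n * (2 * q div n) + n" by (simp add: algebra_simps)
    moreover have "n * (2 * q div n) + 2 * q mod n = 2 * q" by (rule mult_div_mod_eq)
    moreover have "2 * q mod n < n" using n by simp
    ultimately show ?thesis by linarith
  qed
  have h2: "int h * n \<le> 3 * q"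
  proof -
    have "n * (2 * q div n) \<le> 2 * q" 
      using mult_div_mod_eq[of n "2 * q"] pos_mod_sign[of n "2 * q"] n by linarith
    moreover have "int h = 2 * q div n + 1" unfolding h_def using n q0 by (simp add: pos_imp_zdiv_nonneg_iff)
    ultimately show ?thesis using nq by (simp add: algebra_simps)
  qed
  have K0: "int K = int h + m div q + 1" unfolding K_def using q0 qm by (simp add: pos_imp_zdiv_nonneg_iff)
  have K1: "int h * q + m \<le> int K * q"
  proof -
    have "int K * q = int h * q + q * (m div q) + q" using K0 by (simp add: algebra_simps)
    moreover have "q * (m div q) + m mod q = m" by (rule mult_div_mod_eq)
    moreover have "m mod q < q" using q0 by simp
    ultimately show ?thesis by linarith
  qed
  have K2: "int (h + K) * n \<le> 8 * m"
  proof -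
    have "n * (m div q) \<le> q * (m div q)"
      using nq q0 qm by (intro mult_right_mono) (auto simp: pos_imp_zdiv_nonneg_iff)
    also have "\<dots> \<le> m" using mult_div_mod_eq[of q m] pos_mod_sign[of q m] q0 by linarith
    finally have "n * (m div q) \<le> m" .
    then show ?thesis using h2 nq qm K0 by (simp add: algebra_simps)
  qed
  have nn: "int (card A) \<le> 2 * n" using n n_def by simp
  \<comment> \<open>Each of the \<open>h + K\<close> summands carries the shift \<open>u\<close>,
    and \<open>g * (int h * q)\<close> is the rescaled start of the interval.\<close>
  have ex: "\<exists>Z. set_mset Z \<subseteq> A \<and> size Z \<le> h + K \<and> sum_mset Z = (int (h + K) * u + g * (int h * q)) + i * g"
    if i: "i \<in> {1..m}" for i
  proof -
    have "int (card A' - 1) = n" using cA' n by linarith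
    then have hh: "2 * q \<le> int (h * (card A' - 1))" using h1 by (metis of_nat_mult)
    have "\<exists>Z. set_mset Z \<subseteq> A' \<and> size Z = h + K \<and> sum_mset Z = int h * q + i"
      by (rule sums_cover_interval[OF A'q A'0 q q0 Gcd1 hh]) (use i K1 in auto)
    then obtain Z where Z: "set_mset Z \<subseteq> A'" "size Z = h + K" "sum_mset Z = int h * q + i" by blast
    let ?Z = "image_mset (\<lambda>y. u + g * y) Z"
    have "set_mset ?Z \<subseteq> A" using Z(1) gx unfolding A'_def by auto
    moreover have "sum_mset ?Z = int (size Z) * u + g * sum_mset Z"
      by (induction Z) (auto simp: algebra_simps)
    ultimately show ?thesis using Z by (intro exI[of _ ?Z]) (auto simp: algebra_simps)
  qed
  have dA: "g * int (card A) \<le> 16 * l"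
  proof -
    have "g * int (card A) \<le> g * (2 * n)" using nn g0 by simp
    also have "\<dots> \<le> g * (2 * q)" using nq g0 by simp
    also have "\<dots> \<le> 16 * l" using gq g0 q0 by (simp add: algebra_simps) (smt (verit) mult_pos_pos)
    finally show ?thesis .
  qed
  have kA: "int (h + K) * int (card A) \<le> 16 * m"
  proof -
    have "int (h + K) * int (card A) \<le> int (h + K) * (2 * n)" using nn by (intro mult_left_mono) auto
    then show ?thesis using K2 by (simp add: algebra_simps)
  qed
  show ?thesis using g0 dA kA ex by blast
qed

section \<open>Popular sums\<close>

text \<open>Each unordered pair is represented by its smaller member. The strict inequality excludes
  \<open>x = s - x\<close>, so no pair needs two copies of one number.\<close>

definition sum_pairs :: "int set \<Rightarrow> int \<Rightarrow> int set" where
  "sum_pairs A s = {x \<in> A. s - x \<in> A \<and> x < s - x}"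

text \<open>The new term is \<open>1 - ?r\<close>, at most \<open>- ln ?r\<close>; since
  \<open>ln 2 \<le> 1\<close>, passing to base 2 only enlarges this, and the result is the increase
  of the right-hand side.\<close>

lemma harmonic_sum_le_log:
  assumes "1 \<le> N"
  shows "(\<Sum>t=1..N. 1 / real t) \<le> lg (2 * real N)"
  using assms
proof (induction N rule: nat_induct_at_least)
  case base
  then show ?case by simp
next
  case (Suc N)
  let ?r = "real N / real (Suc N)"
  have r: "0 < ?r" "?r < 1" using Suc.hyps by auto
  have ln2: "0 < ln (2::real)" "ln (2::real) \<le> 1" using ln_le_minus_one[of "2::real"] by auto
  have "1 / real (Suc N) = 1 - ?r" by (simp add: field_simps)
  also have "\<dots> \<le> - ln ?r" using ln_le_minus_one[OF r(1)] by simp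
  also have "\<dots> \<le> - ln ?r / ln 2"
  proof -
    have "0 \<le> - ln ?r" using r ln_le_zero_iff[OF r(1)] by linarith
    from mult_left_mono[OF ln2(2) this] show ?thesis
      using ln2(1) by (simp only: pos_le_divide_eq)
  qed
  also have "- ln ?r / ln 2 = lg (2 * real (Suc N)) - lg (2 * real N)"
    using Suc.hyps by (simp add: log_def ln_div ln_mult diff_divide_distrib add_divide_distrib del: of_nat_Suc)
  finally show ?case using Suc.IH by simp
qed

lemma card_increasing_pairs:
  fixes A :: "int set"
  assumes "finite A"
  shows "2 * card {(x, y) \<in> A \<times> A. x < y} + card A = (card A)\<^sup>2"
proof -
  let ?T = "{(x, y) \<in> A \<times> A. x < y}" and ?D = "(\<lambda>x. (x, x)) ` A"
  have f: "finite ?T" "finite (prod.swap ` ?T)" "finite ?D"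
    using assms by (auto intro: finite_subset[of _ "A \<times> A"])
  have "A \<times> A = ?T \<union> prod.swap ` ?T \<union> ?D" by (auto simp: image_iff)
  then have "card (A \<times> A) = card (?T \<union> prod.swap ` ?T \<union> ?D)" by (rule arg_cong)
  also have "\<dots> = card (?T \<union> prod.swap ` ?T) + card ?D"
    using f by (intro card_Un_disjoint) auto
  also have "card (?T \<union> prod.swap ` ?T) = card ?T + card (prod.swap ` ?T)"
    using f by (intro card_Un_disjoint) auto
  also have "card (prod.swap ` ?T) = card ?T" by (simp add: card_image)
  also have "card ?D = card A" by (simp add: card_image inj_on_def)
  finally show ?thesis by (simp add: card_cartesian_product power2_eq_square)
qed

text \<open>
  If every \<open>t\<close> failed, summing over \<open>t\<close> would count fewer than
  \<open>N\<^sup>2 / 4\<close> increasing pairs; the harmonic sum is absorbed by \<open>L\<close>.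
\<close>
lemma exists_popular_sums:
  fixes A :: "int set" and L :: real
  defines "N \<equiv> card A"
  assumes fin: "finite A" and N: "2 \<le> N" and L: "(\<Sum>t=1..N. 1 / real t) \<le> L"
  shows "\<exists>t S. 1 \<le> t \<and> finite S \<and> (\<forall>s\<in>S. t \<le> card (sum_pairs A s)) \<and>
           real N / 8 + (real N)\<^sup>2 / (8 * L * real t) \<le> real (card S)"
proof (rule ccontr)
  assume neg: "\<not> ?thesis"
  define U where "U = (\<lambda>(x, y). x + y) ` (A \<times> A)"
  define S where "S = (\<lambda>t. {s \<in> U. t \<le> card (sum_pairs A s)})"
  have finU: "finite U" unfolding U_def using fin by auto
  have finP: "finite (sum_pairs A s)" for s unfolding sum_pairs_def using fin by auto
  have "real (card (S t)) < real N / 8 + (real N)\<^sup>2 / (8 * L * real t)" if "1 \<le> t" for t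
  proof -
    have "finite (S t)" "\<forall>s\<in>S t. t \<le> card (sum_pairs A s)" using finU unfolding S_def by auto
    then show ?thesis using neg that not_le by blast
  qed
  then have "(\<Sum>t=1..N. real (card (S t))) < (\<Sum>t=1..N. real N / 8 + (real N)\<^sup>2 / (8 * L * real t))"
    using N by (intro sum_strict_mono) auto
  also have "\<dots> = (real N)\<^sup>2 / 8 + (real N)\<^sup>2 / (8 * L) * (\<Sum>t=1..N. 1 / real t)"
    by (simp add: sum.distrib sum_distrib_left power2_eq_square)
  also have "\<dots> \<le> (real N)\<^sup>2 / 8 + (real N)\<^sup>2 / (8 * L) * L"
  proof -
    have "0 \<le> (\<Sum>t=1..N. 1 / real t)" by (intro sum_nonneg) auto
    then show ?thesis using L by (intro add_left_mono mult_left_mono) auto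
  qed
  also have "\<dots> \<le> (real N)\<^sup>2 / 4" by simp
  finally have upper: "real (\<Sum>t=1..N. card (S t)) < (real N)\<^sup>2 / 4" by simp
  have "card {(x, y) \<in> A \<times> A. x < y} \<le> card (Sigma U (sum_pairs A))"
  proof (rule surj_card_le)
    show "finite (Sigma U (sum_pairs A))" using finU finP by auto
    show "{(x, y) \<in> A \<times> A. x < y} \<subseteq> (\<lambda>(s, x). (x, s - x)) ` Sigma U (sum_pairs A)"
    proof clarify
      fix x y assume "x \<in> A" "y \<in> A" "x < y"
      then show "(x, y) \<in> (\<lambda>(s, x). (x, s - x)) ` Sigma U (sum_pairs A)"
        by (intro image_eqI[of _ _ "(x + y, x)"]) (auto simp: U_def sum_pairs_def)
    qed
  qed
  also have "\<dots> = (\<Sum>s\<in>U. card (sum_pairs A s))" using finU finP by simp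
  \<comment> \<open>Layer-cake summation: a cardinality is the number of positive thresholds it
    reaches, and those up to \<open>N\<close> suffice because \<open>sum_pairs A s\<close> is a
    subset of \<open>A\<close>.\<close>
  also have "\<dots> = (\<Sum>s\<in>U. \<Sum>t=1..N. if t \<le> card (sum_pairs A s) then 1 else 0)"
  proof (rule sum.cong)
    fix s
    have "card (sum_pairs A s) \<le> N" unfolding N_def sum_pairs_def using fin by (intro card_mono) auto
    then have "{1..N} \<inter> {t. t \<le> card (sum_pairs A s)} = {1..card (sum_pairs A s)}" by auto
    then show "card (sum_pairs A s) = (\<Sum>t=1..N. if t \<le> card (sum_pairs A s) then 1 else 0)"
      by (simp add: sum.If_cases)
  qed simp
  also have "\<dots> = (\<Sum>t=1..N. card (S t))"
    unfolding S_def using finU by (subst sum.swap) (simp add: sum.If_cases Int_def)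
  finally have "2 * (\<Sum>t=1..N. card (S t)) + N \<ge> N\<^sup>2"
    using card_increasing_pairs[OF fin] unfolding N_def by linarith
  then have "real (N\<^sup>2) \<le> real (2 * (\<Sum>t=1..N. card (S t)) + N)" by (simp only: of_nat_le_iff)
  then have "(real N)\<^sup>2 \<le> 2 * real (\<Sum>t=1..N. card (S t)) + real N" by simp
  \<comment> \<open>This absorbs the contribution \<open>N\<close> of the diagonal pairs.\<close>
  moreover have "2 * real N \<le> (real N)\<^sup>2" using N by (simp add: power2_eq_square)
  ultimately show False using upper by linarith
qed

section \<open>Realising multisets of popular sums as subset sums\<close>

lemma sum_count_le_size: "finite W \<Longrightarrow> (\<Sum>x\<in>W. count Y x) \<le> size Y"
proof -
  assume W: "finite W"
  have "(\<Sum>x\<in>W. count Y x) = (\<Sum>x\<in>W \<inter> set_mset Y. count Y x)"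
    using W by (intro sum.mono_neutral_right) (auto simp: not_in_iff)
  also have "\<dots> \<le> (\<Sum>x\<in>set_mset Y. count Y x)" by (intro sum_mono2) auto
  also have "\<dots> = size Y" by (simp add: size_multiset_overloaded_eq)
  finally show ?thesis .
qed

text \<open>
  Greedy choice of the pairs: the pairs with sum \<open>s\<close> are disjoint, so an element
  of \<open>A\<close> that is used up blocks at most one of them.
\<close>
lemma popular_sums_realizable:
  fixes A S :: "int set" and X Z :: "int multiset"
  assumes fin: "finite A" and M: "\<And>a. a \<in> A \<Longrightarrow> M \<le> count X a"
    and pop: "\<And>s. s \<in> S \<Longrightarrow> 2 * k \<le> card (sum_pairs A s) * M"
    and Z: "set_mset Z \<subseteq> S" "size Z \<le> k"
  shows "\<exists>Y. Y \<subseteq># X \<and> size Y = 2 * size Z \<and> sum_mset Y = sum_mset Z"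
  using Z
proof (induction Z)
  case empty
  then show ?case by (intro exI[of _ "{#}"]) auto
next
  case (add s Z)
  then obtain Y where Y: "Y \<subseteq># X" "size Y = 2 * size Z" "sum_mset Y = sum_mset Z" by auto
  let ?P = "sum_pairs A s"
  \<comment> \<open>If every pair were blocked, \<open>Y\<close> would hold at least
    \<open>M\<close> copies of some member of each of these disjoint pairs, hence at least
    \<open>2 * k\<close> elements. But \<open>size Y = 2 * size Z\<close> is smaller, as
    \<open>s\<close> is still to be added.\<close>
  have "\<exists>x\<in>?P. count Y x < count X x \<and> count Y (s - x) < count X (s - x)"
  proof (rule ccontr)
    assume neg: "\<not> ?thesis"
    have finP: "finite ?P" using fin by (simp add: sum_pairs_def)
    have "M \<le> count Y x + count Y (s - x)" if x: "x \<in> ?P" for x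
      using neg M[of x] M[of "s - x"] x by (auto simp: sum_pairs_def not_less)
    then have "card ?P * M \<le> (\<Sum>x\<in>?P. count Y x + count Y (s - x))"
      using sum_bounded_below[of ?P M "\<lambda>x. count Y x + count Y (s - x)"] by simp
    also have "\<dots> = (\<Sum>x\<in>?P. count Y x) + (\<Sum>x\<in>(\<lambda>x. s - x) ` ?P. count Y x)"
      by (simp add: sum.distrib sum.reindex inj_on_def)
    also have "\<dots> = (\<Sum>x\<in>?P \<union> (\<lambda>x. s - x) ` ?P. count Y x)"
      using finP by (intro sum.union_disjoint[symmetric]) (auto simp: sum_pairs_def)
    also have "\<dots> \<le> size Y" using finP by (intro sum_count_le_size) auto
    finally show False using pop[of s] add.prems Y by auto
  qed
  then obtain x where x: "x \<in> ?P" "count Y x < count X x" "count Y (s - x) < count X (s - x)" by blast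
  have "x \<noteq> s - x" using x(1) by (simp add: sum_pairs_def)
  let ?Y = "add_mset x (add_mset (s - x) Y)"
  have "?Y \<subseteq># X"
    using x \<open>x \<noteq> s - x\<close> Y(1) by (auto simp: subseteq_mset_def Suc_le_eq)
  then show ?case using Y by (intro exI[of _ ?Y]) auto
qed

text \<open>Popular sums feed \<open>sums_contain_progression\<close>. The constant is
  \<open>256 = 16 * 8 * 2\<close>: the 8 compares \<open>card A\<close> with \<open>card S\<close>,
  and the 2 is the doubled range \<open>{1..2 * l}\<close> for the step size, or the two elements of
  \<open>X\<close> per popular sum for the number of summands.\<close>

lemma progression_of_large_multiplicity:
  fixes X :: "int multiset" and A :: "int set" and l m :: int and L :: real
  assumes X: "\<And>x. x \<in># X \<Longrightarrow> 0 < x \<and> x \<le> l"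
    and A: "A \<subseteq> set_mset X" "A \<noteq> {}" "\<And>a. a \<in> A \<Longrightarrow> M \<le> count X a"
    and L: "(\<Sum>t=1..card A. 1 / real t) \<le> L"
    and m: "2 * l \<le> m" "16992 * real_of_int m * L \<le> (real (card A))\<^sup>2 * real M"
  shows "\<exists>d a k. 0 < d \<and> d * int (card A) \<le> 256 * l \<and> int k * int (card A) \<le> 256 * m \<and>
           (\<forall>i\<in>{1..m}. \<exists>Y. Y \<subseteq># X \<and> size Y \<le> k \<and> sum_mset Y = a + i * d)"
proof -
  have fin: "finite A" using A finite_subset by blast
  have N1: "1 \<le> card A" using A fin by (simp add: Suc_le_eq card_gt_0_iff)
  obtain x0 where "x0 \<in> A" using A by auto
  then have "0 < x0 \<and> x0 \<le> l" using X A by auto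
  then have l: "0 < l" by linarith
  have L1: "1 \<le> L"
  proof -
    have "(\<Sum>t=1..1. 1 / real t) \<le> (\<Sum>t=1..card A. 1 / real t)"
      using N1 by (intro sum_mono2) auto
    then show ?thesis using L by simp
  qed
  show ?thesis
  \<comment> \<open>A single number forms no pairs, but then the bound on \<open>m\<close>
    guarantees at least \<open>m\<close> copies of it.\<close>
  proof (cases "card A = 1")
    case True
    then obtain x where x: "A = {x}" by (auto simp: card_1_singleton_iff)
    have "16992 * real_of_int m * 1 \<le> 16992 * real_of_int m * L"
      using L1 l m(1) by (intro mult_left_mono) auto
    also have "\<dots> \<le> real M" using m(2) True by simp
    finally have "real_of_int m \<le> real M" using l m(1) by simp
    then have mM: "m \<le> int (count X x)" using A(3)[of x] x by auto
    have "\<exists>Y. Y \<subseteq># X \<and> size Y \<le> nat m \<and> sum_mset Y = 0 + i * x" if "i \<in> {1..m}" for i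
    proof -
      have "replicate_mset (nat i) x \<subseteq># X"
        using that mM by (auto simp flip: count_le_replicate_mset_subset_eq)
      then show ?thesis using that
        by (intro exI[of _ "replicate_mset (nat i) x"]) (auto simp: sum_mset_replicate_mset)
    qed
    moreover have "0 < x" "x \<le> l" using X A x by auto
    ultimately show ?thesis
      using True l m by (intro exI[of _ x] exI[of _ 0] exI[of _ "nat m"]) auto
  next
    case False
    let ?N = "real (card A)"
    obtain t S where t: "1 \<le> t" and S: "finite S" "\<And>s. s \<in> S \<Longrightarrow> t \<le> card (sum_pairs A s)"
      and big: "?N / 8 + ?N\<^sup>2 / (8 * L * real t) \<le> real (card S)"
      using exists_popular_sums[OF fin _ L] False N1 by force
    \<comment> \<open>The two terms of \<open>big\<close> are used separately: the first bounds
      \<open>card S\<close> from below, the second bounds \<open>t * card S\<close>.\<close>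
    have "0 \<le> ?N\<^sup>2 / (8 * L * real t)" using L1 by simp
    then have NS: "?N \<le> 8 * real (card S)" using big by linarith
    have "?N\<^sup>2 / (8 * L * real t) \<le> real (card S)" using big by simp
    then have tS: "?N\<^sup>2 \<le> 8 * L * real t * real (card S)"
      using L1 t by (simp add: divide_le_eq mult.commute)
    have S0: "0 < card S" using NS N1 by linarith
    have Sl: "S \<subseteq> {1..2 * l}"
    proof
      fix s assume "s \<in> S"
      then have "card (sum_pairs A s) \<noteq> 0" using S(2)[of s] t by linarith
      then obtain x where "x \<in> sum_pairs A s" by (metis card.empty ex_in_conv)
      then have "x \<in># X" "s - x \<in># X" using A unfolding sum_pairs_def by auto
      then show "s \<in> {1..2 * l}" using X[of x] X[of "s - x"] by auto
    qed
    obtain d a k where d: "0 < d" "d * int (card S) \<le> 16 * (2 * l)"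
      and k: "int k * int (card S) \<le> 16 * m"
      and Z: "\<And>i. i \<in> {1..m} \<Longrightarrow> \<exists>Z. set_mset Z \<subseteq> S \<and> size Z \<le> k \<and> sum_mset Z = a + i * d"
      using sums_contain_progression[OF Sl _ m(1)] S0 by (metis card.empty less_irrefl)
    have NSi: "int (card A) \<le> 8 * int (card S)" using NS by linarith
    have "d * int (card A) \<le> 256 * l"
    proof -
      have "d * int (card A) \<le> d * (8 * int (card S))" using NSi d by (intro mult_left_mono) auto
      then show ?thesis using d(2) by linarith
    qed
    moreover have "int (2 * k) * int (card A) \<le> 256 * m"
    proof -
      have "int k * int (card A) \<le> int k * (8 * int (card S))" using NSi by (intro mult_left_mono) auto
      then show ?thesis using k by simp
    qed
    moreover have "\<exists>Y. Y \<subseteq># X \<and> size Y \<le> 2 * k \<and> sum_mset Y = a + i * d" if i: "i \<in> {1..m}" for i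
    proof -
      \<comment> \<open>The factor 1062 matches the hypothesis on \<open>m\<close>, as
        \<open>16 * 1062 = 16992\<close>. After cancelling \<open>L * card S\<close>, the ratio
        \<open>1062 / 8\<close> exceeds the required 2.\<close>
      have "2 * k \<le> t * M"
      proof -
        have "real_of_int (int k * int (card S)) \<le> real_of_int (16 * m)" using k by (simp only: of_int_le_iff)
        then have "real k * real (card S) \<le> 16 * real_of_int m" by simp
        then have "(real k * real (card S)) * (1062 * L) \<le> (16 * real_of_int m) * (1062 * L)"
          using L1 by (intro mult_right_mono) auto
        also have "\<dots> \<le> ?N\<^sup>2 * real M" using m(2) by simp
        also have "\<dots> \<le> 8 * L * real t * real (card S) * real M"
          using tS by (intro mult_right_mono) auto
        finally have "(1062 * real k) * (L * real (card S)) \<le> (8 * real t * real M) * (L * real (card S))"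
          by (simp add: algebra_simps)
        then have "1062 * real k \<le> 8 * real t * real M"
          using L1 S0 by (subst (asm) mult_le_cancel_right_pos) auto
        then have "2 * real k \<le> real t * real M" using of_nat_0_le_iff[of k] by linarith
        then have "2 * real k \<le> real t * real M" using of_nat_0_le_iff[of k] by linarith
        then have "real (2 * k) \<le> real (t * M)" by simp
        then show ?thesis by (simp only: of_nat_le_iff)
      qed
      then have "2 * k \<le> card (sum_pairs A s) * M" if "s \<in> S" for s
        using S(2)[OF that] by (meson le_trans mult_le_mono1)
      moreover obtain Z where "set_mset Z \<subseteq> S" "size Z \<le> k" "sum_mset Z = a + i * d"
        using Z[OF i] by blast
      ultimately show ?thesis
        using popular_sums_realizable[OF fin A(3), of S k Z] by (metis mult_le_mono2)
    qed
    ultimately show ?thesis using d(1) by blast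
  qed
qed

section \<open>Dyadic classes of multiplicities\<close>

text \<open>Pigeonhole over the integer part of the binary logarithm of the multiplicity: there are
  at most \<open>lg (2 * \<mu>)\<close> classes. In the chosen class multiplicities are at most
  \<open>\<mu>\<close> and at most \<open>2 * M\<close> with \<open>M = 2 ^ j\<close>, which gives
  the two estimates.\<close>

lemma dyadic_multiplicity_class:
  fixes X :: "int multiset"
  assumes "X \<noteq> {#}"
  defines "\<mu> \<equiv> real (max_mult X)"
  shows "\<exists>A M. A \<subseteq> set_mset X \<and> A \<noteq> {} \<and> (\<forall>a\<in>A. M \<le> count X a) \<and>
           real (size X) \<le> real (card A) * \<mu> * lg (2 * \<mu>) \<and>
           real (size X) \<le> real (card A) * (2 * real M) * lg (2 * \<mu>)"
proof -
  have cpos: "1 \<le> count X x" if "x \<in># X" for x using that by (simp add: Suc_le_eq)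
  have cmax: "count X x \<le> max_mult X" if "x \<in># X" for x
    unfolding max_mult_def using that by (intro Max_ge) auto
  obtain x0 where "x0 \<in># X" using assms(1) by auto
  then have \<mu>1: "1 \<le> \<mu>" using cpos[of x0] cmax[of x0] unfolding \<mu>_def by linarith
  define f where "f = (\<lambda>x. nat \<lfloor>lg (real (count X x))\<rfloor>)"
  define J where "J = nat \<lfloor>lg \<mu>\<rfloor>"
  define g where "g = (\<lambda>j. \<Sum>x\<in>{x \<in> set_mset X. f x = j}. count X x)"
  have "f ` set_mset X \<subseteq> {0..J}"
  proof
    fix j assume "j \<in> f ` set_mset X"
    then obtain x where x: "x \<in># X" "j = f x" by auto
    have "1 \<le> real (count X x)" "real (count X x) \<le> \<mu>"
      using cpos[OF x(1)] cmax[OF x(1)] unfolding \<mu>_def by linarith+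
    then have "lg (real (count X x)) \<le> lg \<mu>"
      by (subst log_le_cancel_iff) linarith+
    then show "j \<in> {0..J}" unfolding x(2) f_def J_def by (auto intro!: nat_mono floor_mono)
  qed
  then have gsum: "(\<Sum>j=0..J. g j) = size X"
    unfolding g_def size_multiset_overloaded_eq by (intro sum.group) auto
  have "\<exists>j\<in>{0..J}. size X \<le> (J + 1) * g j"
  proof (rule ccontr)
    assume "\<not> ?thesis"
    then have "(J + 1) * g j < size X" if "j \<in> {0..J}" for j using that by (meson not_le)
    then have "(\<Sum>j=0..J. (J + 1) * g j) < (\<Sum>j=0..J. size X)"
      by (intro sum_strict_mono) simp_all
    moreover have "(\<Sum>j=0..J. (J + 1) * g j) = (J + 1) * size X"
      by (simp only: sum_distrib_left[symmetric] gsum)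
    ultimately show False by simp
  qed
  then obtain j where j: "size X \<le> (J + 1) * g j" by auto
  define A where "A = {x \<in> set_mset X. f x = j}"
  have J: "real (J + 1) \<le> lg (2 * \<mu>)"
  proof -
    have "real J \<le> lg \<mu>" unfolding J_def using \<mu>1 by simp
    then show ?thesis using \<mu>1 by (simp add: log_mult)
  qed
  have bound: "real (size X) \<le> real (card A) * c * lg (2 * \<mu>)"
    if c: "\<And>x. x \<in> A \<Longrightarrow> real (count X x) \<le> c" for c
  proof -
    have "real (g j) \<le> real (card A) * c"
      using sum_bounded_above[of A "\<lambda>x. real (count X x)" c] c unfolding g_def A_def by simp
    moreover have "real (size X) \<le> real (J + 1) * real (g j)"
      using j by (metis of_nat_le_iff of_nat_mult)
    moreover have "real (J + 1) * real (g j) \<le> lg (2 * \<mu>) * real (g j)"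
      using J by (intro mult_right_mono) auto
    moreover have "lg (2 * \<mu>) * real (g j) \<le> lg (2 * \<mu>) * (real (card A) * c)"
      using J calculation(1) by (intro mult_left_mono) auto
    ultimately show ?thesis by (simp add: mult.commute)
  qed
  have pw: "2 ^ j \<le> count X x \<and> count X x \<le> 2 * 2 ^ j" if "x \<in> A" for x
  proof -
    have x: "x \<in># X" "j = f x" using that unfolding A_def by auto
    have c1: "1 \<le> real (count X x)" using cpos[OF x(1)] by simp
    have "real j = of_int \<lfloor>lg (real (count X x))\<rfloor>" unfolding x(2) f_def using c1 by simp
    then have "real j \<le> lg (real (count X x))" "lg (real (count X x)) \<le> real j + 1" by linarith+
    then have "2 powr (real j) \<le> real (count X x)" "real (count X x) \<le> 2 powr (real j + 1)"
      using c1 by (simp_all add: le_log_iff log_le_iff)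
    then have "real (2 ^ j) \<le> real (count X x)" "real (count X x) \<le> real (2 * 2 ^ j)"
      by (simp_all add: powr_realpow powr_add)
    then show ?thesis by (simp only: of_nat_le_iff)
  qed
  have "g j \<noteq> 0" using j \<open>x0 \<in># X\<close> by (metis assms(1) le_zero_eq mult_0_right size_eq_0_iff_empty)
  then have "A \<noteq> {}" unfolding g_def A_def by auto
  moreover have "real (size X) \<le> real (card A) * \<mu> * lg (2 * \<mu>)"
    using cmax by (intro bound) (auto simp: A_def \<mu>_def)
  moreover have "real (size X) \<le> real (card A) * (2 * real (2 ^ j)) * lg (2 * \<mu>)"
    using pw by (intro bound) (metis of_nat_le_iff of_nat_mult of_nat_numeral)
  ultimately show ?thesis using pw by (intro exI[of _ A] exI[of _ "2 ^ j"]) (auto simp: A_def)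
qed

theorem theorem4p15:
  fixes X :: "int multiset" and n :: nat and m :: int
  assumes "X \<noteq> {#}"
    and "\<And>x. x \<in># X \<Longrightarrow> 0 < x"
    and "size X = n"
    and "2 * max_elem X \<le> m"
    and "real_of_int m \<le> (real n)\<^sup>2 /
           (33984 * real (max_mult X) * lg (2 * real n) * (lg (2 * real (max_mult X)))\<^sup>2)"
  shows "\<exists>P s. arith_prog m s P \<and> P \<subseteq> subset_sums X
     \<and> real_of_int s \<le> 4248 * real (max_mult X) * real_of_int (max_elem X)
          * lg (2 * real (max_mult X)) / real n
     \<and> (\<forall>p\<in>P. \<exists>Y. Y \<subseteq># X \<and> sum_mset Y = p
          \<and> real (size Y) \<le> 4248 * real_of_int m * real (max_mult X)
               * lg (2 * real (max_mult X)) / real n)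
     \<and> real_of_int (Max P) \<le> 4248 * real_of_int m * real (max_mult X)
          * real_of_int (max_elem X) * lg (2 * real (max_mult X)) / real n"
proof -
  define l where "l = max_elem X"
  define \<mu> where "\<mu> = real (max_mult X)"
  define L where "L = lg (2 * real n)"
  define \<Lambda> where "\<Lambda> = lg (2 * \<mu>)"
  have xl: "x \<le> l" if "x \<in># X" for x
    unfolding l_def max_elem_def using that by (intro Max_ge) auto
  obtain x0 where x0: "x0 \<in># X" using assms(1) by auto
  have l0: "0 < l" using xl[OF x0] assms(2)[OF x0] by linarith
  have m0: "0 < m" using l0 assms(4) unfolding l_def by linarith
  have n0: "0 < n" using assms(1,3) by (auto simp: nonempty_has_size)
  have "count X x0 \<le> max_mult X"
    unfolding max_mult_def using x0 by (intro Max_ge) auto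
  moreover have "1 \<le> count X x0" using x0 by (simp add: Suc_le_eq)
  ultimately have \<mu>1: "1 \<le> \<mu>" unfolding \<mu>_def by linarith
  have \<Lambda>1: "1 \<le> \<Lambda>" unfolding \<Lambda>_def using \<mu>1 by (simp add: le_log_iff)
  obtain A M where A: "A \<subseteq> set_mset X" "A \<noteq> {}" "\<And>a. a \<in> A \<Longrightarrow> M \<le> count X a"
    and N\<mu>: "real n \<le> real (card A) * \<mu> * \<Lambda>" and NM: "real n \<le> real (card A) * (2 * real M) * \<Lambda>"
    using dyadic_multiplicity_class[OF assms(1)] assms(3) unfolding \<mu>_def \<Lambda>_def by metis
  let ?N = "real (card A)"
  have N0: "1 \<le> card A" using A finite_subset[OF A(1)] by (simp add: Suc_le_eq card_gt_0_iff)
  have Nn: "card A \<le> n"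
  proof -
    have "card A \<le> card (set_mset X)" using A by (intro card_mono) auto
    also have "\<dots> = (\<Sum>x\<in>set_mset X. 1)" by simp
    also have "\<dots> \<le> size X"
      unfolding size_multiset_overloaded_eq by (intro sum_mono) (simp add: Suc_le_eq)
    finally show ?thesis using assms(3) by simp
  qed
  have "lg (2 * ?N) \<le> L" unfolding L_def using Nn N0 n0 by (subst log_le_cancel_iff) auto
  then have harm: "(\<Sum>t=1..card A. 1 / real t) \<le> L" using harmonic_sum_le_log[OF N0] by linarith
  have L1: "1 \<le> L" unfolding L_def using n0 by (simp add: le_log_iff)
  \<comment> \<open>The product of the bounds \<open>N\<mu>\<close> and \<open>NM\<close> bounds
    \<open>n ^ 2\<close>; cancelling \<open>2 * \<mu> * \<Lambda>\<^sup>2\<close> then halves 33984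
    to 16992.\<close>
  have "16992 * real_of_int m * L \<le> ?N\<^sup>2 * real M"
  proof -
    have pos: "0 < 33984 * \<mu> * L * \<Lambda>\<^sup>2" using \<mu>1 L1 \<Lambda>1 by simp
    have "real_of_int m * (33984 * \<mu> * L * \<Lambda>\<^sup>2) \<le> (real n)\<^sup>2"
      using assms(5) pos_le_divide_eq[OF pos] unfolding \<mu>_def L_def \<Lambda>_def by simp
    also have "\<dots> \<le> (?N * \<mu> * \<Lambda>) * (?N * (2 * real M) * \<Lambda>)"
      unfolding power2_eq_square using N\<mu> NM \<mu>1 \<Lambda>1 by (intro mult_mono) auto
    finally have "(16992 * real_of_int m * L) * (2 * \<mu> * \<Lambda>\<^sup>2) \<le> (?N\<^sup>2 * real M) * (2 * \<mu> * \<Lambda>\<^sup>2)"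
      by (simp add: power2_eq_square algebra_simps)
    then show ?thesis using \<mu>1 \<Lambda>1 by (subst (asm) mult_le_cancel_right_pos) auto
  qed
  then obtain d a k where d: "0 < d" "d * int (card A) \<le> 256 * l"
    and k: "int k * int (card A) \<le> 256 * m"
    and Y: "\<And>i. i \<in> {1..m} \<Longrightarrow> \<exists>Y. Y \<subseteq># X \<and> size Y \<le> k \<and> sum_mset Y = a + i * d"
    using progression_of_large_multiplicity[of X l A M L m] A harm assms(2,4) xl unfolding l_def by blast
  \<comment> \<open>\<open>N\<mu>\<close> trades \<open>card A\<close> for \<open>n\<close>, and 256
    is at most 4248. This serves the step size with \<open>w = l\<close> and the number of summands
    with \<open>w = m\<close>.\<close>
  have convert: "real_of_int v \<le> 4248 * real_of_int w * \<mu> * \<Lambda> / real n"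
    if vw: "v * int (card A) \<le> 256 * w" and v: "0 \<le> v" for v w
  proof -
    have "real_of_int (v * int (card A)) \<le> real_of_int (256 * w)" using vw by (simp only: of_int_le_iff)
    then have vw': "real_of_int v * ?N \<le> 256 * real_of_int w" by simp
    have "0 \<le> v * int (card A)" using v by simp
    then have w: "0 \<le> w" using vw by linarith
    have "real_of_int v * real n \<le> real_of_int v * (?N * \<mu> * \<Lambda>)"
      using N\<mu> v by (intro mult_left_mono) auto
    also have "\<dots> = (real_of_int v * ?N) * (\<mu> * \<Lambda>)" by simp
    also have "\<dots> \<le> (4248 * real_of_int w) * (\<mu> * \<Lambda>)"
      using vw' w \<mu>1 \<Lambda>1 by (intro mult_right_mono) auto
    finally show ?thesis using n0 by (simp add: le_divide_eq mult.assoc)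
  qed
  define P where "P = {a + i * d | i. 1 \<le> i \<and> i \<le> m}"
  have Pimg: "P = (\<lambda>i. a + i * d) ` {1..m}" unfolding P_def by auto
  have PY: "\<exists>Y. Y \<subseteq># X \<and> size Y \<le> k \<and> sum_mset Y = p" if "p \<in> P" for p
    using that Y unfolding Pimg by auto
  have kb: "real k \<le> 4248 * real_of_int m * \<mu> * \<Lambda> / real n" using convert[OF k] by simp
  have "arith_prog m d P" unfolding arith_prog_def P_def using d by blast
  moreover have "P \<subseteq> subset_sums X" using PY unfolding subset_sums_def by blast
  moreover have "real_of_int d \<le> 4248 * \<mu> * real_of_int l * \<Lambda> / real n"
    using convert[OF d(2)] d(1) by (simp add: mult.commute mult.left_commute)
  moreover have "\<forall>p\<in>P. \<exists>Y. Y \<subseteq># X \<and> sum_mset Y = p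
      \<and> real (size Y) \<le> 4248 * real_of_int m * \<mu> * \<Lambda> / real n"
    using PY kb by (meson of_nat_mono order_trans)
  moreover have "real_of_int (Max P) \<le> 4248 * real_of_int m * \<mu> * real_of_int l * \<Lambda> / real n"
  proof -
    have "Max P \<in> P" using m0 unfolding Pimg by (intro Max_in) auto
    then obtain Y where Y: "Y \<subseteq># X" "size Y \<le> k" "sum_mset Y = Max P" using PY by blast
    have "sum_mset W \<le> int (size W) * l" if "\<And>x. x \<in># W \<Longrightarrow> x \<le> l" for W
      using that by (induction W) (auto simp: algebra_simps add_mono)
    then have "Max P \<le> int (size Y) * l" using Y xl mset_subset_eqD by metis
    also have "\<dots> \<le> int k * l" using Y l0 by (intro mult_right_mono) auto
    finally have "real_of_int (Max P) \<le> real_of_int (int k * l)" by (simp only: of_int_le_iff)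
    also have "\<dots> = real k * real_of_int l" by simp
    also have "\<dots> \<le> (4248 * real_of_int m * \<mu> * \<Lambda> / real n) * real_of_int l"
      using kb l0 by (intro mult_right_mono) auto
    finally show ?thesis by (simp add: mult.commute mult.left_commute)
  qed
  ultimately show ?thesis unfolding \<mu>_def \<Lambda>_def l_def by blast
qed

end
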